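(* Let $p$ be a prime satisfying $\phi(p-1) \leq (p-1)/4$, where $\phi$ is Euler's totient function. Then there exist two consecutive integers $n, n+1$ (with $1 \le n$ and $n+1 \le p-1$) such that each of $n$ and $n+1$ is a quadratic non-residue modulo $p$ and neither $n$ nor $n+1$ is a primitive root modulo $p$.
   Context: An integer $a$ coprime to $p$ is a quadratic non-residue modulo $p$ if $x^2 \equiv a \pmod p$ has no solution; it is a primitive root modulo $p$ if its multiplicative order modulo $p$ is $p-1$. A quadratic non-residue that is not a primitive root is called a QNRNP; the theorem asserts that such $p$ has two consecutive QNRNPs. *)

theory Defs
  imports Complex_Main "HOL-Number_Theory.Number_Theory"
begin

(* QuadRes holds in particular for multiples of p and does not ask for coprimality,
   so coprimality is required separately here. *)
definition quad_nonresidue :: "nat \<Rightarrow> nat \<Rightarrow> bool" where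
  "quad_nonresidue p a \<longleftrightarrow> coprime a p \<and> \<not> QuadRes (int p) (int a)"

(* For prime p, residue_primroot p a says that a is coprime to p and
   ord p a = totient p = p - 1. *)
definition qnrnp :: "nat \<Rightarrow> nat \<Rightarrow> bool" where
  "qnrnp p a \<longleftrightarrow> quad_nonresidue p a \<and> \<not> residue_primroot p a"

end

(* Let q be the least odd prime dividing p - 1 and g a primitive root.  Every element of the coset
   C = {g^(2qi+q)} of the group H = {g^(2qi)} is a QNRNP.  If no two elements of C are consecutive,
   then no point of C x C lies on a line y = s x + h with s, h in H, since dividing by h would give
   consecutive elements h^-1 s x and h^-1 y of C.  A second moment bound for incidences in the
   affine plane over F_p then yields ((p - 1) / 2q)^4 <= p^3, that is, roughly p <= 16 q^4.
   The totient condition forces p - 1 to have many odd prime factors, all at least q, which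
   contradicts this when q >= 5.  When q = 3 only p <= 1300 with 30 | p - 1 remain. *)

theory Submission
  imports Defs
begin

section \<open>Incidences of points and lines over F_p\<close>

text \<open>
  If \<open>r(z)\<close> is the number of lines through the point \<open>z\<close>, then \<open>r\<close> has mean \<open>c = |L| / p\<close> over
  the plane and \<open>\<Sum>(r(z) - c)\<^sup>2 \<le> p |L|\<close>, because two distinct lines meet at most once. Each point
  of \<open>P\<close> contributes \<open>c\<^sup>2\<close> to that sum.
\<close>
lemma no_incidence_bound:
  fixes p :: nat and P L :: "(nat \<times> nat) set"
  assumes p: "prime p"
    and P: "P \<subseteq> {..<p} \<times> {..<p}" and L: "L \<subseteq> {..<p} \<times> {..<p}"
    and none: "\<And>x y s h. (x, y) \<in> P \<Longrightarrow> (s, h) \<in> L \<Longrightarrow> y \<noteq> (s * x + h) mod p"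
  shows "card P * card L \<le> p ^ 3"
proof (cases "L = {}")
  case False
  have p0: "p > 0" using p prime_gt_0_nat by blast
  have finL: "finite L" using L finite_subset by blast
  define A where "A = {..<p} \<times> {..<p}"
  have finA: "finite A" by (simp add: A_def)
  \<comment> \<open>A pair \<open>(s, h)\<close> encodes the non-vertical line y = s x + h.\<close>
  define val where "val = (\<lambda>l x. (fst l * x + snd l) mod p)"
  have val_less: "val l x < p" for l x using p0 by (simp add: val_def)
  define I :: "nat \<times> nat \<Rightarrow> nat \<times> nat \<Rightarrow> real" where "I = (\<lambda>z l. of_bool (snd z = val l (fst z)))"
  define r where "r = (\<lambda>z. \<Sum>l\<in>L. I z l)"
  define c where "c = real (card L) / real p"
  have sum_A: "(\<Sum>z\<in>A. f z) = (\<Sum>x<p. \<Sum>y<p. f (x, y))" for f :: "nat \<times> nat \<Rightarrow> real"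
    unfolding A_def by (simp add: sum.cartesian_product)
  have sum_r: "(\<Sum>z\<in>A. r z) = real p * real (card L)"
  proof -
    have "(\<Sum>z\<in>A. r z) = (\<Sum>l\<in>L. \<Sum>z\<in>A. I z l)"
      unfolding r_def by (rule sum.swap)
    also have "\<dots> = (\<Sum>l\<in>L. real p)"
      using val_less by (intro sum.cong refl) (simp add: sum_A I_def of_bool_def sum.delta)
    finally show ?thesis by simp
  qed
  \<comment> \<open>Distinct lines share at most one point. The summand 1 is kept for
    \<open>l = l'\<close> as well, so that summing over all pairs gives |L|^2 + p |L|, whose first
    term cancels in the variance.\<close>
  have two: "(\<Sum>z\<in>A. I z l * I z l') \<le> 1 + (if l = l' then real p else 0)"
    if l: "l \<in> L" "l' \<in> L" for l l'
  proof -
    have "(\<Sum>y<p. I (x, y) l * I (x, y) l') = of_bool (val l x = val l' x)" for x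
    proof -
      have "(\<Sum>y<p. I (x, y) l * I (x, y) l') = (\<Sum>y<p. if y = val l x then of_bool (val l x = val l' x) else 0)"
        by (intro sum.cong refl) (auto simp: I_def)
      thus ?thesis using val_less by simp
    qed
    hence "(\<Sum>z\<in>A. I z l * I z l') = real (card {x\<in>{..<p}. val l x = val l' x})"
      by (simp add: sum_A sum.If_cases of_bool_def Int_def)
    moreover have "card {x\<in>{..<p}. val l x = val l' x} \<le> p"
      using card_mono[of "{..<p}" "{x\<in>{..<p}. val l x = val l' x}"] by auto
    moreover have "card {x\<in>{..<p}. val l x = val l' x} \<le> 1" if ne: "l \<noteq> l'"
    proof (rule ccontr)
      assume "\<not> ?thesis"
      then obtain x x' where x: "x < p" "x' < p" "x \<noteq> x'" "val l x = val l' x" "val l x' = val l' x'"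
        using card_le_Suc0_iff_eq[of "{x\<in>{..<p}. val l x = val l' x}"] by auto
      obtain s h s' h' where sh: "l = (s, h)" "l' = (s', h')" by fastforce
      have b: "s < p" "h < p" "s' < p" "h' < p" using l L sh by auto
      have c1: "[int s * int x + int h = int s' * int x + int h'] (mod int p)"
        and c2: "[int s * int x' + int h = int s' * int x' + int h'] (mod int p)"
        using x(4,5) by (auto simp: val_def sh cong_def simp flip: of_nat_mult of_nat_add of_nat_mod)
      have "int p dvd (int s - int s') * int x + (int h - int h')"
        and d1: "int p dvd (int s - int s') * int x' + (int h - int h')"
        using c1 c2 by (simp_all add: cong_iff_dvd_diff algebra_simps)
      \<comment> \<open>Two common points with different abscissas force equal slopes, and then
        equal intercepts, because all coordinates lie below p.\<close>
      from dvd_diff[OF this] have "int p dvd (int s - int s') * (int x - int x')"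
        by (simp add: algebra_simps)
      hence "int p dvd int s - int s' \<or> int p dvd int x - int x'"
        using p by (simp add: prime_dvd_mult_iff)
      moreover have small: "a = b" if "int p dvd int a - int b" "a < p" "b < p" for a b
        using that by (metis cong_iff_dvd_diff cong_int_iff cong_less_modulus_unique_nat)
      ultimately have "s = s'" using x b by blast
      hence "h = h'" using d1 small b by simp
      thus False using ne sh \<open>s = s'\<close> by simp
    qed
    ultimately show ?thesis by auto
  qed
  have sum_r2: "(\<Sum>z\<in>A. (r z)\<^sup>2) \<le> (real (card L))\<^sup>2 + real p * real (card L)"
  proof -
    have "(\<Sum>z\<in>A. (r z)\<^sup>2) = (\<Sum>z\<in>A. \<Sum>l\<in>L. \<Sum>l'\<in>L. I z l * I z l')"
      by (simp add: r_def power2_eq_square sum_product)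
    also have "\<dots> = (\<Sum>l\<in>L. \<Sum>z\<in>A. \<Sum>l'\<in>L. I z l * I z l')"
      by (rule sum.swap)
    also have "\<dots> = (\<Sum>l\<in>L. \<Sum>l'\<in>L. \<Sum>z\<in>A. I z l * I z l')"
      by (intro sum.cong refl sum.swap)
    also have "\<dots> \<le> (\<Sum>l\<in>L. \<Sum>l'\<in>L. 1 + (if l = l' then real p else 0))"
      by (intro sum_mono two)
    also have "\<dots> = (real (card L))\<^sup>2 + real p * real (card L)"
      using finL by (simp add: sum.distrib power2_eq_square algebra_simps)
    finally show ?thesis .
  qed
  have "real (card P) * c\<^sup>2 = (\<Sum>z\<in>P. (r z - c)\<^sup>2)"
  proof -
    have "r z = 0" if "z \<in> P" for z
      unfolding r_def I_def using none[of "fst z" "snd z"] that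
      by (intro sum.neutral) (auto simp: val_def)
    thus ?thesis by simp
  qed
  also have "\<dots> \<le> (\<Sum>z\<in>A. (r z - c)\<^sup>2)"
    using P finA by (intro sum_mono2) (auto simp: A_def)
  also have "\<dots> = (\<Sum>z\<in>A. (r z)\<^sup>2) - 2 * c * (\<Sum>z\<in>A. r z) + real (card A) * c\<^sup>2"
    unfolding sum_distrib_left by (simp add: power2_diff sum.distrib sum_subtractf mult_ac)
  also have "\<dots> \<le> real p * real (card L)"
  proof -
    have "real (card A) * c\<^sup>2 = (real (card L))\<^sup>2" and "c * (real p * real (card L)) = (real (card L))\<^sup>2"
      using p0 by (simp_all add: c_def A_def power2_eq_square)
    thus ?thesis using sum_r2 unfolding sum_r mult.assoc by linarith
  qed
  finally have "real (card P) * real (card L) * real (card L) \<le> real p ^ 3 * real (card L)"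
    using p0 by (simp add: c_def field_simps power2_eq_square power3_eq_cube)
  moreover have "real (card L) > 0" using False finL by (simp add: card_gt_0_iff)
  ultimately have "real (card P) * real (card L) \<le> real p ^ 3"
    by simp
  thus ?thesis by (simp flip: of_nat_mult of_nat_power)
qed simp

text \<open>Take C x C as points and H x H as lines. Multiplying an incidence y = s x + h by an
  inverse \<open>h'\<close> of h from H gives h' y = h' s x + 1 modulo p, where h' y and h' s x both
  lie in C.\<close>

lemma no_consecutive_bound:
  fixes p :: nat and C H :: "nat set"
  assumes p: "prime p"
    and C: "C \<subseteq> {0<..<p}" and H: "H \<subseteq> {..<p}"
    and closed: "\<And>s x. s \<in> H \<Longrightarrow> x \<in> C \<Longrightarrow> s * x mod p \<in> C"
    and inverse: "\<And>h. h \<in> H \<Longrightarrow> \<exists>h'\<in>H. [h' * h = 1] (mod p)"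
    and none: "\<And>x. x \<in> C \<Longrightarrow> x + 1 \<notin> C"
  shows "(card C * card H)\<^sup>2 \<le> p ^ 3"
proof -
  have "card (C \<times> C) * card (H \<times> H) \<le> p ^ 3"
  proof (rule no_incidence_bound[OF p])
    fix x y s h assume xy: "(x, y) \<in> C \<times> C" and sh: "(s, h) \<in> H \<times> H"
    show "y \<noteq> (s * x + h) mod p"
    proof
      assume eq: "y = (s * x + h) mod p"
      obtain h' where h': "h' \<in> H" "[h' * h = 1] (mod p)" using inverse sh by auto
      define X where "X = h' * (s * x mod p) mod p"
      define Y where "Y = h' * y mod p"
      have XY: "X \<in> C" "Y \<in> C" using xy sh h' closed by (auto simp: X_def Y_def)
      hence X: "X < p" "Y < p" "Y > 0" using C by auto
      have "[Y = h' * (s * x) + h' * h] (mod p)"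
        unfolding Y_def eq cong_def by (simp add: mod_simps algebra_simps)
      also have "[h' * (s * x) + h' * h = h' * (s * x) + 1] (mod p)"
        using h' by (intro cong_add) auto
      also have "[h' * (s * x) + 1 = X + 1] (mod p)"
        unfolding X_def cong_def by (simp add: mod_simps)
      finally have "Y = (X + 1) mod p" using X by (simp add: cong_def)
      \<comment> \<open>Wraparound at \<open>X + 1 = p\<close> would make \<open>Y\<close> zero, but
        C avoids 0.\<close>
      hence "Y = X + 1" using X by (cases "X + 1 = p") auto
      thus False using none XY by blast
    qed
  qed (use C H in auto)
  thus ?thesis by (simp add: card_cartesian_product power2_eq_square algebra_simps)
qed

section \<open>A coset of non-residues that are not primitive roots\<close>

text \<open>Euler's criterion turns \<open>half\<close> into non-residuosity. The exponent
  \<open>d\<close> keeps the order below p - 1 and, being positive, also yields coprimality of a and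
  p.\<close>

lemma qnrnpI:
  fixes p a d :: nat
  assumes p: "prime p" "p > 2"
    and half: "\<not> [a ^ ((p - 1) div 2) = 1] (mod p)"
    and d: "[a ^ d = 1] (mod p)" "0 < d" "d < p - 1"
  shows "qnrnp p a"
proof -
  have cop: "coprime a p"
    using d cong_imp_coprime[OF cong_sym[OF d(1)]] by simp
  have "\<not> QuadRes (int p) (int a)"
  proof
    assume "QuadRes (int p) (int a)"
    moreover have "\<not> [int a = 0] (mod int p)"
      using cop p by (metis cong_0_iff coprime_absorb_right int_dvd_int_iff not_prime_unit)
    ultimately have "Legendre (int a) (int p) = 1" by (simp add: Legendre_def)
    hence "[int a ^ ((p - 1) div 2) = 1] (mod int p)"
      using euler_criterion[OF p, of "int a"] by (simp add: cong_sym)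
    thus False using half by (metis cong_int_iff of_nat_1 of_nat_power)
  qed
  moreover have "\<not> residue_primroot p a"
  proof
    assume "residue_primroot p a"
    hence "ord p a = p - 1" using p by (simp add: residue_primroot_def totient_prime)
    moreover have "ord p a dvd d" using d(1) by (simp only: ord_divides)
    ultimately show False using d by (auto dest: dvd_imp_le)
  qed
  ultimately show ?thesis using cop by (simp add: qnrnp_def quad_nonresidue_def)
qed

text \<open>Write p - 1 = 2 q f. An element g^(q (2i + 1)) is a non-residue because its exponent is
  odd, and its order divides 2 f < p - 1 because the exponent is a multiple of q. The fourth power
  arises as |C|^2 |H|^2, each set having at least f elements.\<close>

lemma no_consecutive_qnrnp_bound:
  fixes p q :: nat
  assumes p: "prime p" and q: "odd q" "q > 1" "2 * q dvd p - 1"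
    and none: "\<And>n. 1 \<le> n \<Longrightarrow> n + 1 \<le> p - 1 \<Longrightarrow> qnrnp p n \<Longrightarrow> \<not> qnrnp p (n + 1)"
  shows "((p - 1) div (2 * q)) ^ 4 \<le> p ^ 3"
proof -
  define f where "f = (p - 1) div (2 * q)"
  have pf: "p - 1 = 2 * q * f" using q by (simp add: f_def)
  have p1: "p > 1" using p prime_gt_1_nat by blast
  hence f0: "f > 0" using pf by (cases f) auto
  have "1 * 1 < q * f" using q(2) f0 by (intro mult_less_le_imp_less) auto
  hence p2: "p > 2" using pf by simp
  obtain g where g: "residue_primroot p g" using prime_primitive_root_exists[OF p1 p] by blast
  hence ordg: "ord p g = p - 1" and copg: "coprime p g"
    using p by (auto simp: residue_primroot_def totient_prime)
  define H where "H = range (\<lambda>i. g ^ (2 * q * i) mod p)"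
  define C where "C = range (\<lambda>i. g ^ (2 * q * i + q) mod p)"
  \<comment> \<open>The shift \<open>a\<close> is 0 for \<open>H\<close> and q for \<open>C\<close>.
    The f exponents are distinct modulo 2 q f, the order of g.\<close>
  have pow_inj: "inj_on (\<lambda>i. g ^ (2 * q * i + a) mod p) {..<f}" for a
  proof (rule inj_onI)
    fix i j assume ij: "i \<in> {..<f}" "j \<in> {..<f}" "g ^ (2 * q * i + a) mod p = g ^ (2 * q * j + a) mod p"
    hence "[2 * q * i + a = 2 * q * j + a] (mod (2 * q * f))"
      using order_divides_expdiff[of p g "2 * q * i + a" "2 * q * j + a"] copg ordg pf
      by (simp add: cong_def)
    hence "[2 * q * i = 2 * q * j] (mod (2 * q * f))" by (simp add: cong_add_rcancel_nat)
    hence "2 * q * i = 2 * q * j"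
      using ij q by (intro cong_less_modulus_unique_nat[of _ _ "2 * q * f"]) auto
    thus "i = j" using q by simp
  qed
  have Hsub: "H \<subseteq> {..<p}" using p1 by (auto simp: H_def)
  have Csub: "C \<subseteq> {0<..<p}"
  proof -
    have "\<not> p dvd g ^ k" for k
      using copg p by (metis coprime_absorb_left not_prime_unit prime_dvd_power)
    thus ?thesis using p1 by (auto simp: C_def dvd_eq_mod_eq_0)
  qed
  have "f \<le> card H"
    using card_image[OF pow_inj[of 0]] card_mono[of H "(\<lambda>i. g ^ (2 * q * i) mod p) ` {..<f}"] Hsub
    by (auto simp: H_def intro: finite_subset)
  moreover have "f \<le> card C"
    using card_image[OF pow_inj[of q]] card_mono[of C "(\<lambda>i. g ^ (2 * q * i + q) mod p) ` {..<f}"] Csub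
    by (auto simp: C_def intro: finite_subset)
  ultimately have "(f * f)\<^sup>2 \<le> (card C * card H)\<^sup>2"
    by (intro power_mono mult_mono) auto
  also have "\<dots> \<le> p ^ 3"
  proof (rule no_consecutive_bound[OF p Csub Hsub])
    fix s x assume "s \<in> H" "x \<in> C"
    then obtain i j where ij: "s = g ^ (2 * q * i) mod p" "x = g ^ (2 * q * j + q) mod p"
      by (auto simp: H_def C_def)
    have "s * x mod p = g ^ (2 * q * (i + j) + q) mod p"
      by (simp add: ij mod_simps algebra_simps flip: power_add)
    thus "s * x mod p \<in> C" by (auto simp: C_def)
  next
    fix h assume "h \<in> H"
    then obtain i where i: "h = g ^ (2 * q * i) mod p" by (auto simp: H_def)
    \<comment> \<open>The natural number i (f - 1) replaces -i: the two exponents add up to a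
      multiple of p - 1.\<close>
    have "[g ^ (2 * q * (i * (f - 1))) mod p * h = g ^ (2 * q * (i * (f - 1)) + 2 * q * i)] (mod p)"
      by (simp add: i cong_def mod_simps power_add)
    also have "2 * q * (i * (f - 1)) + 2 * q * i = (p - 1) * i"
      unfolding pf using f0 by (cases f) (auto simp: algebra_simps)
    also have "[g ^ ((p - 1) * i) = 1] (mod p)"
      by (simp only: ord_divides ordg dvd_triv_left)
    finally show "\<exists>h'\<in>H. [h' * h = 1] (mod p)" by (auto simp: H_def)
  next
    have qn: "qnrnp p x" if "x \<in> C" for x
    proof (rule qnrnpI[OF p p2])
      from that obtain i where i: "x = g ^ (q * (2 * i + 1)) mod p"
        by (auto simp: C_def algebra_simps)
      have xk: "[x ^ k = 1] (mod p) \<longleftrightarrow> p - 1 dvd q * (2 * i + 1) * k" for k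
      proof -
        have "[x ^ k = 1] (mod p) \<longleftrightarrow> [g ^ (q * (2 * i + 1) * k) = 1] (mod p)"
          by (simp only: i cong_def power_mod power_mult)
        thus ?thesis by (simp only: ord_divides ordg)
      qed
      show "\<not> [x ^ ((p - 1) div 2) = 1] (mod p)"
      proof
        assume "[x ^ ((p - 1) div 2) = 1] (mod p)"
        hence "2 * (q * f) dvd (q * (2 * i + 1)) * (q * f)"
          unfolding xk pf by (simp add: mult.assoc)
        hence "2 dvd q * (2 * i + 1)" using q f0 by (subst (asm) dvd_times_right_cancel_iff) auto
        thus False using q by simp
      qed
      show "[x ^ (2 * f) = 1] (mod p)"
        unfolding xk pf by (simp add: mult_ac)
      show "0 < 2 * f" using f0 by simp
      show "2 * f < p - 1" unfolding pf using q f0 by simp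
    qed
    fix x assume x: "x \<in> C"
    show "x + 1 \<notin> C"
    proof
      assume "x + 1 \<in> C"
      moreover from this have "1 \<le> x" "x + 1 \<le> p - 1" using x Csub by auto
      ultimately show False using qn x none by blast
    qed
  qed
  finally show ?thesis by (simp add: f_def flip: power2_eq_square power_mult)
qed

section \<open>Products of 1 - 1/r over odd primes r\<close>

text \<open>
  The extremal case is \<open>K = {q, q + 2, \<dots>}\<close>. Squaring makes the bound telescope, since
  \<open>(1 - 1 / m)\<^sup>2 \<ge> (m - 2) / m\<close>.
\<close>
lemma prod_one_minus_inverse_odd_ge:
  fixes K :: "nat set" and q :: nat
  assumes "finite K" and "\<And>r. r \<in> K \<Longrightarrow> odd r \<and> q \<le> r" and q: "odd q" "q \<ge> 3"
  shows "(real q - 2) / (real q + 2 * real (card K) - 2) \<le> (\<Prod>r\<in>K. 1 - 1 / real r)\<^sup>2"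
  using assms(1,2)
proof (induction K rule: finite_linorder_max_induct)
  case empty
  then show ?case using q by simp
next
  case (insert b K)
  define k where "k = card K"
  \<comment> \<open>Counting the odd numbers from q to the new maximum \<open>b\<close> shows that
    \<open>b\<close> is at least q + 2 k.\<close>
  have "(\<lambda>i. (i - q) div 2) ` insert b K \<subseteq> {..(b - q) div 2}"
    using insert.hyps by (auto simp: div_le_mono)
  moreover have "inj_on (\<lambda>i. (i - q) div 2) (insert b K)"
  proof (rule inj_onI)
    fix i j assume ij: "i \<in> insert b K" "j \<in> insert b K" "(i - q) div 2 = (j - q) div 2"
    hence "even (i - q)" "even (j - q)" "q \<le> i" "q \<le> j" using insert.prems q by auto
    thus "i = j" using ij(3) by (metis dvd_div_eq_cancel eq_diff_iff)
  qed
  ultimately have "card (insert b K) \<le> (b - q) div 2 + 1"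
    by (metis card_atMost card_inj_on_le finite_atMost Suc_eq_plus1)
  moreover have "card (insert b K) = k + 1"
    using insert.hyps by (subst card_insert_disjoint) (auto simp: k_def)
  ultimately have "k \<le> (b - q) div 2" by linarith
  hence b: "q + 2 * k \<le> b"
    using insert.prems(1)[of b] by simp linarith
  have IH: "(real q - 2) / (real q + 2 * real k - 2) \<le> (\<Prod>r\<in>K. 1 - 1 / real r)\<^sup>2"
    using insert by (simp add: k_def)
  define m where "m = real q + 2 * real k"
  have m: "m \<ge> 3" "m \<le> real b" using q b by (simp_all add: m_def)
  have "(m - 2) / m \<le> (1 - 1 / m)\<^sup>2"
    using m by (simp add: power2_eq_square field_simps)
  also have "\<dots> \<le> (1 - 1 / real b)\<^sup>2"
    using m by (intro power_mono) (auto simp: field_simps)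
  finally have 1: "(m - 2) / m \<le> (1 - 1 / real b)\<^sup>2" .
  have "(real q - 2) / m = (m - 2) / m * ((real q - 2) / (m - 2))"
    using m by simp
  also have "\<dots> \<le> (1 - 1 / real b)\<^sup>2 * (\<Prod>r\<in>K. 1 - 1 / real r)\<^sup>2"
    using 1 IH m q by (intro mult_mono) (auto simp: m_def)
  finally show ?case
    using insert by (auto simp: m_def k_def power_mult_distrib)
qed

text \<open>The extremal set is {7, 11}, with 6/7 * 10/11 = 60/77 > 3/4. Multiplied by the factor
  2/3 of the prime 3 this stays above 1/2, so two such primes besides 3 are too few for the totient
  condition.\<close>

lemma prod_one_minus_inverse_primes_ge_7:
  fixes K :: "nat set"
  assumes K: "\<And>r. r \<in> K \<Longrightarrow> prime r \<and> 7 \<le> r" and fin: "finite K" and card: "card K \<le> 2"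
  shows "3 / 4 < (\<Prod>r\<in>K. 1 - 1 / real r)"
proof -
  have ge: "6 / 7 \<le> 1 - 1 / real r" if "r \<in> K" for r
    using K[OF that] by (simp add: field_simps)
  consider "K = {}" | r where "K = {r}" | r s where "K = {r, s}" "r < s"
  proof -
    consider "card K = 0" | "card K = 1" | "card K = 2" using card by linarith
    thus thesis
    proof cases
      case 1 thus ?thesis using that fin by simp
    next
      case 2 thus ?thesis using that by (auto simp: card_1_singleton_iff)
    next
      case 3
      then obtain r s where "K = {r, s}" "r \<noteq> s" by (auto simp: card_2_iff)
      thus ?thesis using that(3)[of r s] that(3)[of s r] by (cases "r < s") (auto simp: insert_commute)
    qed
  qed
  thus ?thesis
  proof cases
    case (2 r)
    thus ?thesis using ge[of r] by simp
  next
    case (3 r s)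
    have "s \<ge> 11"
    proof (rule ccontr)
      assume "\<not> s \<ge> 11"
      moreover have "s > 7" "prime s" using 3 K[of r] K[of s] by auto
      ultimately have "s \<in> {8, 9, 10}" by auto
      thus False using \<open>prime s\<close> by auto
    qed
    hence "10 / 11 \<le> 1 - 1 / real s" by (simp add: field_simps)
    hence "6 / 7 * (10 / 11) \<le> (1 - 1 / real r) * (1 - 1 / real s)"
      using ge[of r] 3 by (intro mult_mono) auto
    thus ?thesis using 3 by simp
  qed simp
qed

lemma power_card_le_prod:
  fixes K :: "nat set"
  assumes "\<And>r. r \<in> K \<Longrightarrow> b \<le> r"
  shows "b ^ card K \<le> \<Prod>K"
  using prod_mono[of K "\<lambda>_. b" "\<lambda>r. r"] assms by simp

lemma prod_primes_dvd:
  fixes K :: "nat set"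
  assumes "finite K" "\<And>r. r \<in> K \<Longrightarrow> prime r" "\<And>r. r \<in> K \<Longrightarrow> r dvd n"
  shows "\<Prod>K dvd n"
  using assms
proof (induction K rule: finite_induct)
  case (insert r K)
  have "coprime r (\<Prod>K)"
    using insert by (intro prod_coprime_right primes_coprime) auto
  thus ?case using insert by (simp add: divides_mult)
qed simp

section \<open>Verification for small p\<close>

text \<open>Square-and-multiply along the binary digits of the exponent. With
  \<open>power_numeral\<close> disabled, these rewrite rules let the simplifier reduce modulo m
  after each squaring instead of evaluating huge powers.\<close>

lemma power_mod_even_exponent:
  "(b::nat) ^ numeral (Num.Bit0 k) mod m = (b * b mod m) ^ numeral k mod m"
  by (simp add: numeral_Bit0 power_add power_mod power_mult_distrib)

lemma power_mod_odd_exponent: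
  "(b::nat) ^ numeral (Num.Bit1 k) mod m = b * ((b * b mod m) ^ numeral k mod m) mod m"
  by (simp only: numeral_Bit1 power_add power_mod power_mult_distrib mod_simps mult_ac power_one_right)

text \<open>This settles the case where 3 and 5 both divide p - 1. Writing p = 30 k + 1 with k < 44
  leaves 24 primes, each with explicit witnesses.\<close>

lemma consecutive_qnrnp_small:
  fixes p :: nat
  assumes p: "prime p" and "p \<le> 1300" and "30 dvd p - 1"
  shows "\<exists>n. 1 \<le> n \<and> n + 1 \<le> p - 1 \<and> qnrnp p n \<and> qnrnp p (n + 1)"
proof -
  \<comment> \<open>By Euler's criterion \<open>n\<close> is a non-residue, and its order divides \<open>d < p - 1\<close>. In the table below
     each \<open>d\<close> is \<open>(p - 1) / 3\<close> or \<open>(p - 1) / 5\<close>.\<close>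
  define N :: "nat \<Rightarrow> nat \<Rightarrow> nat \<Rightarrow> bool" where "N = (\<lambda>p n d. 0 < d \<and> d < p - 1 \<and>
    n ^ ((p - 1) div 2) mod p \<noteq> 1 \<and> n ^ d mod p = 1)"
  define W :: "nat \<Rightarrow> nat \<Rightarrow> nat \<Rightarrow> nat \<Rightarrow> bool" where
    "W = (\<lambda>p n d e. 2 < p \<and> 1 \<le> n \<and> n + 1 \<le> p - 1 \<and> N p n d \<and> N p (n + 1) e)"
  have witnesses:
    "W 31 26 6 10" "W 61 23 20 20" "W 151 23 30 50" "W 181 6 60 60"
    "W 211 26 42 70" "W 241 21 80 48" "W 271 12 54 90" "W 331 7 110 110"
    "W 421 61 140 140" "W 541 32 108 180" "W 571 7 190 190" "W 601 62 200 200"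
    "W 631 27 210 210" "W 661 7 220 220" "W 691 10 230 138" "W 751 6 250 250"
    "W 811 14 270 270" "W 991 46 330 330" "W 1021 6 340 340" "W 1051 2 350 210"
    "W 1171 7 234 390" "W 1201 109 400 240" "W 1231 59 410 246" "W 1291 26 430 430"
    unfolding W_def N_def
    by (simp_all add: power_mod_even_exponent power_mod_odd_exponent del: power_numeral)
  obtain k where k: "p - 1 = 30 * k" using assms by (auto elim: dvdE)
  hence pk: "p = 30 * k + 1" using p prime_gt_0_nat[of p] by linarith
  hence "k < 44" using assms by linarith
  hence "k \<in> set [0..<44]" by simp
  hence "k \<in> {0, 1, 2, 3, 4, 5, 6, 7, 8, 9, 10, 11, 12, 13, 14, 15, 16, 17, 18, 19, 20, 21, 22,
      23, 24, 25, 26, 27, 28, 29, 30, 31, 32, 33, 34, 35, 36, 37, 38, 39, 40, 41, 42, 43}"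
    by (simp add: upt_rec eval_nat_numeral del: set_upt)
  moreover have "k \<noteq> 0" using p pk by (intro notI) simp
  \<comment> \<open>This excludes the composite values: a composite number below \<open>1300\<close> that is coprime to \<open>30\<close>
     has a divisor in this set.\<close>
  moreover have "\<forall>d\<in>{7, 11, 13, 17, 19, 23, 29, 31}. d dvd 30 * k + 1 \<longrightarrow> d = 30 * k + 1"
  proof (intro ballI impI)
    fix d assume "d \<in> {7, 11, 13, 17, 19, 23, 29, 31}" "d dvd 30 * k + 1"
    moreover from this(1) have "d \<noteq> 1" by auto
    ultimately show "d = 30 * k + 1" using p unfolding pk prime_nat_iff by blast
  qed
  ultimately have "30 * k + 1 \<in>
      {31, 61, 151, 181, 211, 241, 271, 331, 421, 541, 571, 601, 631, 661, 691, 751, 811,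
       991, 1021, 1051, 1171, 1201, 1231, 1291}"
    by (elim insertE emptyE) simp_all
  hence "\<exists>n d e. W p n d e"
    unfolding pk[symmetric] by (elim insertE emptyE; hypsubst) (use witnesses in blast)+
  then obtain n d e where "W p n d e" by blast
  thus ?thesis
    using p qnrnpI[of p n d] qnrnpI[of p "n + 1" e] by (auto simp: W_def N_def cong_def)
qed

section \<open>Contradiction with the totient condition\<close>

text \<open>The leading term of the right-hand side is 8 q^3 f^3. The remaining terms stay below 24
  q^2 f^2, which is at most f^3 once f > 8 q^3 >= 24 q^2. Since f is an integer, f >= 8 q^3 + 1 has
  room for this extra f^3.\<close>

lemma le_8_cube_if_power4_le:
  fixes f q :: nat
  assumes le: "f ^ 4 \<le> (2 * q * f + 1) ^ 3" and q: "q \<ge> 3"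
  shows "f \<le> 8 * q ^ 3"
proof (rule ccontr)
  assume "\<not> ?thesis"
  hence f: "8 * q ^ 3 + 1 \<le> f" by simp
  have "24 * q\<^sup>2 \<le> 8 * q ^ 3" using q by (simp add: power2_eq_square power3_eq_cube)
  hence f2: "24 * q\<^sup>2 \<le> f" using f by linarith
  have q1: "q \<le> q\<^sup>2" by (simp add: power2_eq_square)
  have "f \<le> f\<^sup>2" by (simp add: power2_eq_square)
  hence qf: "q * f \<le> q\<^sup>2 * f\<^sup>2" using q1 by (intro mult_mono) auto
  have "q\<^sup>2 * f\<^sup>2 \<noteq> 0" using q f by simp
  have "(2 * q * f + 1) ^ 3 = 8 * q ^ 3 * f ^ 3 + (12 * (q\<^sup>2 * f\<^sup>2) + 6 * (q * f) + 1)"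
    by (simp add: power2_eq_square power3_eq_cube algebra_simps)
  also have "\<dots> < 8 * q ^ 3 * f ^ 3 + 24 * q\<^sup>2 * f\<^sup>2"
    using qf \<open>q\<^sup>2 * f\<^sup>2 \<noteq> 0\<close> unfolding mult.assoc by linarith
  also have "24 * q\<^sup>2 * f\<^sup>2 \<le> f * f\<^sup>2" using f2 by (rule mult_right_mono) simp
  also have "8 * q ^ 3 * f ^ 3 + f * f\<^sup>2 = (8 * q ^ 3 + 1) * f ^ 3"
    by (simp add: power2_eq_square power3_eq_cube algebra_simps)
  also have "\<dots> \<le> f * f ^ 3" using f by (rule mult_right_mono) simp
  finally show False using le by (simp add: eval_nat_numeral)
qed

theorem theorem1:
  fixes p :: nat
  assumes "prime p"
    and "real (totient (p - 1)) \<le> (real p - 1) / 4"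
  shows "\<exists>n::nat. 1 \<le> n \<and> n + 1 \<le> p - 1 \<and> qnrnp p n \<and> qnrnp p (n + 1)"
proof (rule ccontr)
  assume none: "\<not> ?thesis"
  have p2: "p > 2"
    using assms prime_ge_2_nat[of p] by (cases "p = 2") auto
  define m where "m = p - 1"
  have m: "m > 0" "even m"
    using p2 assms(1) prime_odd_nat[of p] by (auto simp: m_def)
  define K where "K = prime_factors m - {2}"
  have K: "finite K" "\<And>r. r \<in> K \<Longrightarrow> prime r \<and> odd r \<and> r dvd m \<and> 3 \<le> r"
  proof -
    show "finite K" by (simp add: K_def)
    fix r assume "r \<in> K"
    hence r: "prime r" "r dvd m" "r \<noteq> 2" by (auto simp: K_def in_prime_factors_iff)
    hence "r > 2" using prime_ge_2_nat[of r] by linarith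
    thus "prime r \<and> odd r \<and> r dvd m \<and> 3 \<le> r" using r prime_odd_nat by auto
  qed
  have pf: "prime_factors m = insert 2 K" "2 \<notin> K"
    using m by (auto simp: K_def in_prime_factors_iff)
  have "real m * (\<Prod>r\<in>prime_factors m. 1 - 1 / real r) \<le> real m / 4"
    using assms(2) p2 unfolding totient_formula2[symmetric] by (simp add: m_def of_nat_diff)
  \<comment> \<open>The prime 2 contributes a factor 1/2 to the Euler product.\<close>
  hence prodK: "(\<Prod>r\<in>K. 1 - 1 / real r) \<le> 1 / 2"
    using m K(1) pf by simp
  have prod_dvd: "2 * \<Prod>K \<le> m"
  proof -
    have "\<Prod>(insert 2 K) dvd m"
      using K m by (intro prod_primes_dvd) auto
    thus ?thesis using m K(1) pf(2) by (auto dest: dvd_imp_le)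
  qed
  define q where "q = Min K"
  have "K \<noteq> {}" using prodK by auto
  hence qK: "q \<in> K" and qmin: "\<And>r. r \<in> K \<Longrightarrow> q \<le> r"
    using K(1) by (simp_all add: q_def)
  have q: "prime q" "odd q" "q dvd m" "q \<ge> 3" using K(2) qK by auto
  have "2 * q dvd m" using q m by (intro divides_mult) auto
  then obtain f where f: "m = 2 * q * f" by (auto elim: dvdE)
  have "f ^ 4 \<le> p ^ 3"
  proof -
    have "((p - 1) div (2 * q)) ^ 4 \<le> p ^ 3"
      using assms(1) q none \<open>2 * q dvd m\<close>
      by (intro no_consecutive_qnrnp_bound) (auto simp: m_def)
    moreover have "(p - 1) div (2 * q) = f" using q f unfolding m_def by simp
    ultimately show ?thesis by simp
  qed
  hence f_le: "f \<le> 8 * q ^ 3"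
    using f p2 q(4) by (intro le_8_cube_if_power4_le) (simp_all add: m_def flip: f)
  define K' where "K' = K - {q}"
  have K': "finite K'" "K = insert q K'" "q \<notin> K'" using K qK by (auto simp: K'_def)
  have "2 * q * \<Prod>K' \<le> 2 * q * f" using prod_dvd f K' by simp
  hence prodK'_le: "\<Prod>K' \<le> f" using q by simp
  show False
  proof (cases "q = 3")
    case False
    hence q5: "q \<ge> 5" using q by (cases "q = 4") auto
    have "(real q - 2) / (real q + 2 * real (card K) - 2) \<le> (\<Prod>r\<in>K. 1 - 1 / real r)\<^sup>2"
      using K qmin q by (intro prod_one_minus_inverse_odd_ge) auto
    also have "\<dots> \<le> (1 / 2)\<^sup>2"
      using prodK K(2) by (intro power_mono prod_nonneg) force+
    finally have "4 * (real q - 2) \<le> real q + 2 * real (card K) - 2"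
      using q5 by (simp add: field_simps power2_eq_square)
    \<comment> \<open>For q >= 5 the inequality gives 2 |K| >= 3 q - 6 >= 9, so K has at least five
      elements, one of which is q.\<close>
    hence "4 \<le> card K'" using q5 K' by simp
    have ge: "q + 2 \<le> r" if "r \<in> K'" for r
    proof -
      have "r \<in> K" "r \<noteq> q" using that K'(2,3) by auto
      hence "q < r" "odd r" using qmin[of r] K(2)[of r] by auto
      thus ?thesis using q(2) by presburger
    qed
    \<comment> \<open>The expansion of (q + 2)^4 contains the term 8 q^3, so four primes beyond q
      already multiply to more than f.\<close>
    have "8 * q ^ 3 < (q + 2) ^ 4"
      using q by (simp add: eval_nat_numeral algebra_simps)
    also have "\<dots> \<le> (q + 2) ^ card K'"
      using \<open>4 \<le> card K'\<close> by (intro power_increasing) auto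
    also have "\<dots> \<le> \<Prod>K'" by (intro power_card_le_prod ge)
    finally show False using prodK'_le f_le by linarith
  next
    case True
    have f216: "f \<le> 216" using f_le True by simp
    show False
    proof (cases "5 \<in> K")
      case True
      hence "5 dvd m" using K(2) by blast
      moreover have "6 dvd m" using f \<open>q = 3\<close> by simp
      ultimately have "30 dvd m" by presburger
      \<comment> \<open>Here p = 6 f + 1 <= 6 * 216 + 1 = 1297.\<close>
      moreover have "p \<le> 1300" using f216 f \<open>q = 3\<close> by (simp add: m_def)
      ultimately show False
        using consecutive_qnrnp_small[OF assms(1)] none unfolding m_def by blast
    next
      case False
      have K'7: "prime r \<and> 7 \<le> r" if "r \<in> K'" for r
      proof -
        have "prime r" "odd r" "3 \<le> r" "r \<noteq> 3" "r \<noteq> 5"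
          using that K(2)[of r] K' False \<open>q = 3\<close> by auto
        thus ?thesis by (cases "r = 4"; cases "r = 6") auto
      qed
      \<comment> \<open>The product over \<open>K'\<close> is at most 3/4, so \<open>K'\<close> has
        at least three primes, all at least 7; but 7^3 = 343 exceeds 216.\<close>
      have "2 / 3 * (\<Prod>r\<in>K'. 1 - 1 / real r) \<le> 1 / 2"
        using prodK K' \<open>q = 3\<close> by simp
      hence "card K' \<ge> 3"
        using prod_one_minus_inverse_primes_ge_7[of K'] K'7 K'(1) by fastforce
      hence "7 ^ 3 \<le> (7::nat) ^ card K'" by (intro power_increasing) auto
      also have "\<dots> \<le> \<Prod>K'" using K'7 by (intro power_card_le_prod) auto
      finally show False using prodK'_le f216 by simp
    qed
  qed
qed

end
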